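(* Let $S\in G$ be given by $S=e^{i\theta}\begin{bmatrix} UA & U(\xi)\\ \langle\cdot,\xi\rangle & a\end{bmatrix}$, $\theta\in\mathbb{R}$, where $\xi\in H$, $a=\sqrt{1+\|\xi\|^2}$, $U$ is a unitary operator on $H$, and $A$ is the positive operator on $H$ with $A(\xi)=a\xi$ and $A=I$ on $\langle\xi\rangle^{\perp}$. Then: (1) $S$ is normal if and only if $S=e^{i\theta}\begin{bmatrix} UA & \xi\\ \langle\cdot,\xi\rangle & a\end{bmatrix}$, i.e. $U(\xi)=\xi$. (2) $S$ is unitary if and only if $S=e^{i\theta}\begin{bmatrix} U & 0\\ 0 & 1\end{bmatrix}$, i.e. $\xi=0$. (3) If $S$ is normal and $\xi\neq0$, then $\sigma(S)=\{a\pm\|\xi\|\}\cup\sigma(U\restriction_{\langle\xi\rangle^{\perp}})$, where $a\pm\|\xi\|$ are both positive, of non-unit modulus, and inverses of each other. The eigenspaces corresponding to the eigenvalues $a\pm\|\xi\|$ are spanned by the eigenvectors $\left(\pm\dfrac{\xi}{\|\xi\|},1\right)$ respectively. (4) If $S$ is normal and $\xi\neq0$, then $S$ is hyperbolic.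
   Context: $H$ is an infinite-dimensional complex Hilbert space with inner product $\langle\cdot,\cdot\rangle$ linear in the first variable; $B$ is its open unit ball, $\partial B$ the unit sphere, $\overline{B}=B\cup\partial B$. On $H\oplus\mathbb{C}$ consider the sesquilinear form $\mathcal{A}((x,\lambda),(y,\mu))=\langle x,y\rangle-\lambda\overline{\mu}$. $G$ is the group of all bijective linear operators on $H\oplus\mathbb{C}$ leaving $\mathcal{A}$ invariant; every element of $G$ has the displayed form. A block matrix $\begin{bmatrix} P & \eta\\ \langle\cdot,\zeta\rangle & c\end{bmatrix}$ denotes the operator $(x,z)\mapsto (P(x)+z\eta,\ \langle x,\zeta\rangle+cz)$ on $H\oplus\mathbb{C}$. Normal and unitary refer to the Hilbert space $H\oplus\mathbb{C}$ with its usual inner product. $\langle\xi\rangle$ is the linear span of $\xi$, and $\sigma(\cdot)$ is the spectrum. Each $T=\begin{bmatrix} P & \eta\\ \langle\cdot,\zeta\rangle & c\end{bmatrix}\in G$ induces a biholomorphic bijection $\widetilde{T}$ of $B$, $\widetilde{T}(x)=\dfrac{P(x)+\eta}{\langle x,\zeta\rangle+c}$, given by the same formula on $\overline{B}$. $T$ is called elliptic if $\widetilde{T}$ has a fixed point in $B$, and hyperbolic if it is not elliptic and $\widetilde{T}$ has exactly two fixed points on $\partial B$.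
   Formalization: In (3) the scalar e^{iθ}, missing from the English, is restored: σ(S) = e^{iθ}({a±‖ξ‖} ∪ σ(U↾⟨ξ⟩^⊥)), with eigenvalues e^{iθ}(a±‖ξ‖); as printed the claim fails whenever e^{iθ} ≠ 1 (e.g. θ = π, U = I). *)

theory Defs
  imports "HOL-Analysis.Analysis"
begin

section \<open>Complex inner product spaces and Hilbert spaces\<close>

text \<open>
  The inner product is linear in the first variable. Norm, metric and topology are those of
  \<^class>\<open>real_normed_vector\<close>; the last axiom ties the norm to the inner product (and makes
  the inner product positive definite).
\<close>

class complex_inner = real_normed_vector +
  fixes scaleC :: "complex \<Rightarrow> 'a \<Rightarrow> 'a"  (infixr "*\<^sub>C" 75)
    and cinner :: "'a \<Rightarrow> 'a \<Rightarrow> complex"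
  assumes scaleC_add_right: "c *\<^sub>C (x + y) = c *\<^sub>C x + c *\<^sub>C y"
    and scaleC_add_left: "(c + d) *\<^sub>C x = c *\<^sub>C x + d *\<^sub>C x"
    and scaleC_scaleC: "c *\<^sub>C (d *\<^sub>C x) = (c * d) *\<^sub>C x"
    and scaleC_of_real: "complex_of_real r *\<^sub>C x = r *\<^sub>R x"
    and cinner_commute: "cinner x y = cnj (cinner y x)"
    and cinner_add_left: "cinner (x + y) z = cinner x z + cinner y z"
    and cinner_scaleC_left: "cinner (c *\<^sub>C x) y = c * cinner x y"
    and cinner_self: "cinner x x = complex_of_real ((norm x)\<^sup>2)"

class complex_hilbert = complex_inner + complete_space

lemma scaleC_one: "1 *\<^sub>C (x::'a::complex_inner) = x"
  using scaleC_of_real [of 1 x] by simp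

global_interpretation complex_vector:
  vector_space "scaleC :: complex \<Rightarrow> 'a \<Rightarrow> 'a::complex_inner"
  by unfold_locales (simp_all add: scaleC_add_right scaleC_add_left scaleC_scaleC scaleC_one)

abbreviation cspan :: "'a::complex_inner set \<Rightarrow> 'a set"
  where "cspan \<equiv> module.span scaleC"

abbreviation clinear :: "('a::complex_inner \<Rightarrow> 'b::complex_inner) \<Rightarrow> bool"
  where "clinear \<equiv> Vector_Spaces.linear scaleC scaleC"

instantiation complex :: complex_hilbert
begin

definition scaleC_complex :: "complex \<Rightarrow> complex \<Rightarrow> complex"
  where "scaleC_complex c z = c * z"

definition cinner_complex :: "complex \<Rightarrow> complex \<Rightarrow> complex"
  where "cinner_complex z w = z * cnj w"

instance
proof
  fix c d :: complex and r :: real and x y z :: complex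
  show "c *\<^sub>C (x + y) = c *\<^sub>C x + c *\<^sub>C y"
    by (simp add: scaleC_complex_def distrib_left)
  show "(c + d) *\<^sub>C x = c *\<^sub>C x + d *\<^sub>C x"
    by (simp add: scaleC_complex_def distrib_right)
  show "c *\<^sub>C (d *\<^sub>C x) = (c * d) *\<^sub>C x"
    by (simp add: scaleC_complex_def)
  show "complex_of_real r *\<^sub>C x = r *\<^sub>R x"
    by (simp add: scaleC_complex_def scaleR_conv_of_real)
  show "cinner x y = cnj (cinner y x)"
    by (simp add: cinner_complex_def mult.commute)
  show "cinner (x + y) z = cinner x z + cinner y z"
    by (simp add: cinner_complex_def distrib_right)
  show "cinner (c *\<^sub>C x) y = c * cinner x y"
    by (simp add: cinner_complex_def scaleC_complex_def)
  show "cinner x x = complex_of_real ((norm x)\<^sup>2)"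
    by (simp only: cinner_complex_def complex_norm_square)
qed

end

text \<open>
  The orthogonal direct sum. The norm on product types is already the Euclidean one,
  so it is induced by this inner product.
\<close>

instantiation prod :: (complex_inner, complex_inner) complex_inner
begin

definition scaleC_prod :: "complex \<Rightarrow> 'a \<times> 'b \<Rightarrow> 'a \<times> 'b"
  where "scaleC_prod c v = (c *\<^sub>C fst v, c *\<^sub>C snd v)"

definition cinner_prod :: "'a \<times> 'b \<Rightarrow> 'a \<times> 'b \<Rightarrow> complex"
  where "cinner_prod v w = cinner (fst v) (fst w) + cinner (snd v) (snd w)"

instance
proof
  fix c d :: complex and r :: real and x y z :: "'a \<times> 'b"
  show "c *\<^sub>C (x + y) = c *\<^sub>C x + c *\<^sub>C y"
    by (simp add: scaleC_prod_def scaleC_add_right)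
  show "(c + d) *\<^sub>C x = c *\<^sub>C x + d *\<^sub>C x"
    by (simp add: scaleC_prod_def scaleC_add_left)
  show "c *\<^sub>C (d *\<^sub>C x) = (c * d) *\<^sub>C x"
    by (simp add: scaleC_prod_def scaleC_scaleC)
  show "complex_of_real r *\<^sub>C x = r *\<^sub>R x"
    by (simp add: scaleC_prod_def scaleC_of_real scaleR_prod_def)
  show "cinner x y = cnj (cinner y x)"
    unfolding cinner_prod_def complex_cnj_add by (intro arg_cong2 [of _ _ _ _ "(+)"] cinner_commute)
  show "cinner (x + y) z = cinner x z + cinner y z"
    by (simp add: cinner_prod_def cinner_add_left)
  show "cinner (c *\<^sub>C x) y = c * cinner x y"
    by (simp add: cinner_prod_def scaleC_prod_def cinner_scaleC_left distrib_left)
  show "cinner x x = complex_of_real ((norm x)\<^sup>2)"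
    by (simp add: cinner_prod_def norm_prod_def cinner_self)
qed

end

instance prod :: (complex_hilbert, complex_hilbert) complex_hilbert ..

definition corth :: "'a::complex_inner set \<Rightarrow> 'a set"
  where "corth M = {x. \<forall>y\<in>M. cinner x y = 0}"


section \<open>Operators\<close>

definition bounded_clinear :: "('a::complex_inner \<Rightarrow> 'b::complex_inner) \<Rightarrow> bool"
  where "bounded_clinear T \<longleftrightarrow> bounded_linear T \<and> (\<forall>c x. T (c *\<^sub>C x) = c *\<^sub>C T x)"

text \<open>
  Adjointness is a relation: there is at most one adjoint, as shown below, and a bounded operator
  on a Hilbert space always has one, so quantifying existentially over the adjoint is harmless.
\<close>

definition is_cadjoint :: "('a::complex_inner \<Rightarrow> 'a) \<Rightarrow> ('a \<Rightarrow> 'a) \<Rightarrow> bool"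
  where "is_cadjoint T R \<longleftrightarrow> (\<forall>x y. cinner (T x) y = cinner x (R y))"

lemma is_cadjoint_unique:
  assumes "is_cadjoint T R" "is_cadjoint T R'"
  shows "R = R'"
proof
  fix y
  have eq: "cinner x (R y) = cinner x (R' y)" for x
    using assms unfolding is_cadjoint_def by metis
  have "cinner (R y) x = cinner (R' y) x" for x
    using eq [of x] by (metis cinner_commute)
  moreover have "cinner (R y) x = cinner (R y - R' y) x + cinner (R' y) x" for x
    by (metis cinner_add_left diff_add_cancel)
  ultimately have "cinner (R y - R' y) (R y - R' y) = 0"
    by simp
  then show "R y = R' y"
    by (simp add: cinner_self)
qed

definition normal_op :: "('a::complex_inner \<Rightarrow> 'a) \<Rightarrow> bool"
  where "normal_op T \<longleftrightarrow> bounded_clinear T \<and>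
    (\<exists>R. bounded_clinear R \<and> is_cadjoint T R \<and> R \<circ> T = T \<circ> R)"

definition unitary_op :: "('a::complex_inner \<Rightarrow> 'a) \<Rightarrow> bool"
  where "unitary_op T \<longleftrightarrow> bounded_clinear T \<and>
    (\<exists>R. bounded_clinear R \<and> is_cadjoint T R \<and> R \<circ> T = id \<and> T \<circ> R = id)"

definition positive_op :: "('a::complex_inner \<Rightarrow> 'a) \<Rightarrow> bool"
  where "positive_op T \<longleftrightarrow> bounded_clinear T \<and> (\<forall>x. cinner (T x) x \<in> \<real>\<^sub>\<ge>\<^sub>0)"

text \<open>
  \<open>bounded_inverse_on M T R\<close>: the restriction of \<open>R\<close> to the subspace \<open>M\<close> is a bounded linear
  operator on \<open>M\<close> and a two-sided inverse of the restriction of \<open>T\<close>. The values of \<open>R\<close> outside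
  \<open>M\<close> are irrelevant. It is only used for subspaces \<open>M\<close> invariant under \<open>T\<close>.
\<close>

definition bounded_inverse_on ::
    "'a::complex_inner set \<Rightarrow> ('a \<Rightarrow> 'a) \<Rightarrow> ('a \<Rightarrow> 'a) \<Rightarrow> bool"
  where "bounded_inverse_on M T R \<longleftrightarrow>
    (\<forall>x\<in>M. R x \<in> M) \<and>
    (\<forall>x\<in>M. \<forall>y\<in>M. R (x + y) = R x + R y) \<and>
    (\<forall>c. \<forall>x\<in>M. R (c *\<^sub>C x) = c *\<^sub>C R x) \<and>
    (\<exists>K. \<forall>x\<in>M. norm (R x) \<le> K * norm x) \<and>
    (\<forall>x\<in>M. R (T x) = x \<and> T (R x) = x)"

definition spectrum_on :: "'a::complex_inner set \<Rightarrow> ('a \<Rightarrow> 'a) \<Rightarrow> complex set"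
  where "spectrum_on M T = {l. \<nexists>R. bounded_inverse_on M (\<lambda>x. T x - l *\<^sub>C x) R}"

abbreviation spectrum :: "('a::complex_inner \<Rightarrow> 'a) \<Rightarrow> complex set"
  where "spectrum \<equiv> spectrum_on UNIV"

definition eigenspace :: "('a::complex_inner \<Rightarrow> 'a) \<Rightarrow> complex \<Rightarrow> 'a set"
  where "eigenspace T l = {v. T v = l *\<^sub>C v}"


section \<open>The automorphism group of the indefinite form and its action on the ball\<close>

definition indef_form :: "'h::complex_inner \<times> complex \<Rightarrow> 'h \<times> complex \<Rightarrow> complex"
  where "indef_form u v = cinner (fst u) (fst v) - snd u * cnj (snd v)"

definition form_group :: "('h::complex_inner \<times> complex \<Rightarrow> 'h \<times> complex) set"
  where "form_group = {T. clinear T \<and> bij T \<and>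
    (\<forall>u v. indef_form (T u) (T v) = indef_form u v)}"

definition block_op ::
    "('h::complex_inner \<Rightarrow> 'h) \<Rightarrow> 'h \<Rightarrow> 'h \<Rightarrow> complex \<Rightarrow> 'h \<times> complex \<Rightarrow> 'h \<times> complex"
  where "block_op P \<eta> \<zeta> c = (\<lambda>(x, z). (P x + z *\<^sub>C \<eta>, cinner x \<zeta> + c * z))"

text \<open>
  The induced map of the closed unit ball, written without naming the blocks of \<open>T\<close>;
  the lemma below recovers the usual formula.
\<close>

definition ball_map :: "('h::complex_inner \<times> complex \<Rightarrow> 'h \<times> complex) \<Rightarrow> 'h \<Rightarrow> 'h"
  where "ball_map T x = inverse (snd (T (x, 1))) *\<^sub>C fst (T (x, 1))"

lemma ball_map_block_op:
  "ball_map (block_op P \<eta> \<zeta> c) x = inverse (cinner x \<zeta> + c) *\<^sub>C (P x + \<eta>)"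
  by (simp add: ball_map_def block_op_def scaleC_one)

definition elliptic :: "('h::complex_inner \<times> complex \<Rightarrow> 'h \<times> complex) \<Rightarrow> bool"
  where "elliptic T \<longleftrightarrow> (\<exists>x\<in>ball 0 1. ball_map T x = x)"

definition hyperbolic :: "('h::complex_inner \<times> complex \<Rightarrow> 'h \<times> complex) \<Rightarrow> bool"
  where "hyperbolic T \<longleftrightarrow> \<not> elliptic T \<and> card {x \<in> sphere 0 1. ball_map T x = x} = 2"

end

theory Submission
  imports Defs
begin

text \<open>
  Since \<open>A x = x + \<langle>x,\<xi>\<rangle>/(a + 1) \<xi>\<close>, the operator \<open>S\<close> is \<open>e\<^sup>i\<^sup>\<theta>\<close> times the product of
  \<open>U \<oplus> 1\<close> and a self-adjoint \<open>M\<close>, so it is normal iff \<open>U \<oplus> 1\<close> commutes with \<open>M\<^sup>2\<close>; evaluating at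
  \<open>(0,1)\<close> gives \<open>U \<xi> = \<xi>\<close>. In that case, with \<open>u = \<xi>/\<parallel>\<xi>\<parallel>\<close>, the space splits orthogonally into
  \<open>u\<^sup>\<bottom>\<close> and the lines through \<open>(u,1)\<close> and \<open>(-u,1)\<close>, on which \<open>S\<close> acts as the multiples by
  \<open>e\<^sup>i\<^sup>\<theta>\<close> of \<open>U\<close>, \<open>a + \<parallel>\<xi>\<parallel>\<close> and \<open>a - \<parallel>\<xi>\<parallel>\<close>. Spectrum and eigenspaces can then be read off, and
  the fixed points of the ball map are the eigenvectors with last component \<open>1\<close>, that is, \<open>u\<close>
  and \<open>-u\<close>.
\<close>

section \<open>Inner products and bounded operators\<close>

lemma cinner_zero_left [simp]: "cinner 0 (y::'a::complex_inner) = 0"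
  using cinner_scaleC_left [of 0 0 y] by simp

lemma cinner_zero_right [simp]: "cinner (x::'a::complex_inner) 0 = 0"
  using cinner_commute [of x 0] by simp

lemma cinner_add_right: "cinner (x::'a::complex_inner) (y + z) = cinner x y + cinner x z"
  by (metis cinner_add_left cinner_commute complex_cnj_add)

lemma cinner_scaleC_right: "cinner (x::'a::complex_inner) (c *\<^sub>C y) = cnj c * cinner x y"
  by (metis cinner_scaleC_left cinner_commute complex_cnj_mult)

lemma cinner_diff_left: "cinner (x - z) (y::'a::complex_inner) = cinner x y - cinner z y"
  using cinner_add_left [of "x - z" z y] by (simp add: algebra_simps)

text \<open>The class supplies only the norm of real multiples; complex multiples are reached by
  pairing the vector with itself.\<close>

lemma norm_scaleC: "norm (c *\<^sub>C (x::'a::complex_inner)) = norm c * norm x"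
proof -
  have "complex_of_real ((norm (c *\<^sub>C x))\<^sup>2) = complex_of_real ((norm c * norm x)\<^sup>2)"
    unfolding cinner_self [symmetric] cinner_scaleC_left cinner_scaleC_right
    by (simp only: cinner_self power_mult_distrib mult.assoc [symmetric] of_real_mult
        complex_norm_square mult.commute)
  then have "(norm (c *\<^sub>C x))\<^sup>2 = (norm c * norm x)\<^sup>2"
    by (simp only: of_real_eq_iff)
  then show ?thesis
    by (rule power2_eq_imp_eq) simp_all
qed

lemma pythagoras:
  assumes "cinner x (y::'a::complex_inner) = 0"
  shows "(norm (x + y))\<^sup>2 = (norm x)\<^sup>2 + (norm y)\<^sup>2"
proof -
  have "cinner y x = 0"
    using assms cinner_commute [of y x] by simp
  then have "complex_of_real ((norm (x + y))\<^sup>2) = complex_of_real ((norm x)\<^sup>2 + (norm y)\<^sup>2)"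
    using assms
    by (simp only: cinner_self [symmetric] cinner_add_left cinner_add_right of_real_add) simp
  then show ?thesis
    by (simp only: of_real_eq_iff)
qed

text \<open>Cauchy-Schwarz: by Pythagoras the orthogonal projection \<open>c *\<^sub>C y\<close> of
  \<open>x\<close> onto the line of \<open>y\<close> is no longer than \<open>x\<close>, and its
  norm times \<open>norm y\<close> is the modulus of the inner product.\<close>

lemma norm_cinner_le: "norm (cinner x (y::'a::complex_inner)) \<le> norm x * norm y"
proof (cases "y = 0")
  case False
  define c where "c = cinner x y / complex_of_real ((norm y)\<^sup>2)"
  have "cinner (x - c *\<^sub>C y) (c *\<^sub>C y) = 0"
    using False by (simp add: cinner_diff_left cinner_scaleC_left cinner_scaleC_right cinner_self c_def)
  then have "(norm x)\<^sup>2 = (norm (x - c *\<^sub>C y))\<^sup>2 + (norm (c *\<^sub>C y))\<^sup>2"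
    using pythagoras [of "x - c *\<^sub>C y" "c *\<^sub>C y"] by simp
  then have "(norm (c *\<^sub>C y))\<^sup>2 \<le> (norm x)\<^sup>2"
    by simp
  then have "norm (c *\<^sub>C y) \<le> norm x"
    by (rule power2_le_imp_le) simp
  moreover have "norm (c *\<^sub>C y) * norm y = norm (cinner x y)"
    using False by (simp add: norm_scaleC c_def norm_divide norm_mult power2_eq_square)
  ultimately show ?thesis
    by (metis mult_right_mono norm_ge_zero)
qed simp

section \<open>Bounded complex-linear operators\<close>

lemma bounded_clinearI:
  assumes "\<And>x y. T (x + y) = T x + T y" and "\<And>c x. T (c *\<^sub>C x) = c *\<^sub>C T x"
    and "\<And>x. norm (T x) \<le> K * norm x"
  shows "bounded_clinear T"
  unfolding bounded_clinear_def
proof (intro conjI allI bounded_linear_intro)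
  show "T (r *\<^sub>R x) = r *\<^sub>R T x" for r x
    using assms(2) [of "complex_of_real r" x] by (simp add: scaleC_of_real)
  show "norm (T x) \<le> norm x * K" for x
    using assms(3) [of x] by (simp add: mult.commute)
qed (fact assms)+

lemma bounded_clinear_add: "bounded_clinear T \<Longrightarrow> T (x + y) = T x + T y"
  unfolding bounded_clinear_def by (simp add: linear_simps)

lemma bounded_clinear_scaleC: "bounded_clinear T \<Longrightarrow> T (c *\<^sub>C x) = c *\<^sub>C T x"
  unfolding bounded_clinear_def by simp

lemma bounded_clinear_bound:
  assumes "bounded_clinear T"
  obtains K where "K \<ge> 0" "\<And>x. norm (T x) \<le> K * norm x"
  using assms bounded_linear.nonneg_bounded unfolding bounded_clinear_def
  by (metis mult.commute)

lemma bounded_clinear_compose: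
  assumes "bounded_clinear T" "bounded_clinear R"
  shows "bounded_clinear (T \<circ> R)"
  using assms bounded_linear_compose unfolding bounded_clinear_def comp_def by fastforce

lemma bounded_clinear_scale:
  assumes "bounded_clinear T"
  shows "bounded_clinear (\<lambda>x. c *\<^sub>C T x)"
proof -
  obtain K where "\<And>x. norm (T x) \<le> K * norm x"
    using bounded_clinear_bound [OF assms] by metis
  then show ?thesis
    by (intro bounded_clinearI [where K = "norm c * K"])
      (simp_all add: bounded_clinear_add [OF assms] bounded_clinear_scaleC [OF assms]
        scaleC_add_right scaleC_scaleC norm_scaleC mult.commute [of c] mult.assoc mult_left_mono)
qed

lemma bounded_clinear_block_op:
  assumes "bounded_clinear P"
  shows "bounded_clinear (block_op P \<eta> \<zeta> c)"
proof -
  obtain K where K: "K \<ge> 0" "\<And>x. norm (P x) \<le> K * norm x"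
    using bounded_clinear_bound [OF assms] by metis
  show ?thesis
  proof (rule bounded_clinearI)
    fix v :: "'a \<times> complex"
    obtain x z where v: "v = (x, z)" by force
    have x: "norm x \<le> norm v" and z: "norm z \<le> norm v"
      using norm_fst_le norm_snd_le by (auto simp: v)
    have "norm (block_op P \<eta> \<zeta> c v) \<le> norm (P x + z *\<^sub>C \<eta>) + norm (cinner x \<zeta> + c * z)"
      by (simp add: v block_op_def norm_Pair_le)
    also have "\<dots> \<le> (norm (P x) + norm (z *\<^sub>C \<eta>)) + (norm (cinner x \<zeta>) + norm (c * z))"
      by (intro add_mono norm_triangle_ineq)
    also have "\<dots> \<le> (K * norm v + norm v * norm \<eta>) + (norm v * norm \<zeta> + norm c * norm v)"
      unfolding norm_scaleC norm_mult
      by (intro add_mono order_trans [OF K(2)] order_trans [OF norm_cinner_le]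
          mult_left_mono mult_right_mono x z K(1)) simp_all
    finally show "norm (block_op P \<eta> \<zeta> c v) \<le> (K + norm \<eta> + norm \<zeta> + norm c) * norm v"
      by (simp add: algebra_simps)
  next
    fix v w :: "'a \<times> complex" and d :: complex
    show "block_op P \<eta> \<zeta> c (v + w) = block_op P \<eta> \<zeta> c v + block_op P \<eta> \<zeta> c w"
      by (simp add: block_op_def split_beta bounded_clinear_add [OF assms] cinner_add_left
          scaleC_add_left distrib_left)
    show "block_op P \<eta> \<zeta> c (d *\<^sub>C v) = d *\<^sub>C block_op P \<eta> \<zeta> c v"
      by (simp add: block_op_def split_beta scaleC_prod_def scaleC_complex_def
          bounded_clinear_scaleC [OF assms] cinner_scaleC_left scaleC_add_right distrib_left
          mult.left_commute)
  qed
qed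

section \<open>Adjoints and unitary operators\<close>

lemma is_cadjoint_compose:
  "is_cadjoint T T' \<Longrightarrow> is_cadjoint R R' \<Longrightarrow> is_cadjoint (T \<circ> R) (R' \<circ> T')"
  by (simp add: is_cadjoint_def)

lemma is_cadjoint_scale:
  "is_cadjoint T R \<Longrightarrow> is_cadjoint (\<lambda>x. c *\<^sub>C T x) (\<lambda>x. cnj c *\<^sub>C R x)"
  by (simp add: is_cadjoint_def cinner_scaleC_left cinner_scaleC_right)

text \<open>This is the conjugate transpose of the block matrix, so the column \<open>\<eta>\<close>
  and the row vector \<open>\<zeta>\<close> trade places.\<close>

lemma is_cadjoint_block_op:
  assumes "is_cadjoint P Q"
  shows "is_cadjoint (block_op P \<eta> \<zeta> c) (block_op Q \<zeta> \<eta> (cnj c))"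
  using assms
  by (auto simp: is_cadjoint_def block_op_def cinner_prod_def cinner_complex_def cinner_add_left
      cinner_add_right cinner_scaleC_left cinner_scaleC_right algebra_simps cinner_commute [of \<eta>])

lemma unitary_opE:
  assumes "unitary_op U"
  obtains V where "bounded_clinear U" "bounded_clinear V" "is_cadjoint U V"
    "\<And>x. V (U x) = x" "\<And>x. U (V x) = x" "\<And>x y. cinner (U x) (U y) = cinner x y"
    "\<And>x. norm (U x) = norm x"
proof -
  obtain V where V: "bounded_clinear U" "bounded_clinear V" "is_cadjoint U V"
      "\<And>x. V (U x) = x" "\<And>x. U (V x) = x"
    using assms unfolding unitary_op_def by (metis comp_apply id_apply)
  then have inner: "cinner (U x) (U y) = cinner x y" for x y
    by (simp add: is_cadjoint_def)
  have "(norm (U x))\<^sup>2 = (norm x)\<^sup>2" for x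
    using inner [of x x] by (simp only: cinner_self of_real_eq_iff)
  then have "norm (U x) = norm x" for x
    by simp
  with V inner that show thesis by blast
qed

lemma corth_cspan_singleton: "corth (cspan {x}) = {y. cinner y (x::'a::complex_inner) = 0}"
  by (auto simp: corth_def complex_vector.span_singleton cinner_scaleC_right
      intro: complex_vector.span_base)

text \<open>Since cT - cm = c(T - m), a bounded inverse for one side rescales to one for the
  other.\<close>

lemma spectrum_on_scale:
  assumes c: "c \<noteq> 0" and M: "\<And>d x. x \<in> M \<Longrightarrow> d *\<^sub>C x \<in> M"
  shows "spectrum_on M (\<lambda>x. c *\<^sub>C T x) = (\<lambda>z. c * z) ` spectrum_on M T"
proof -
  \<comment> \<open>Both inclusions are instances: \<open>d = c\<close>, \<open>l = 1\<close> passes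
    from \<open>T\<close> to its multiple, and \<open>d = inverse c\<close>, \<open>l = c\<close>
    passes back.\<close>
  have scale: "\<exists>R'. bounded_inverse_on M (\<lambda>x. (d * l) *\<^sub>C T x - (d * m) *\<^sub>C x) R'"
    if d: "d \<noteq> 0" and R: "bounded_inverse_on M (\<lambda>x. l *\<^sub>C T x - m *\<^sub>C x) R" for d l m R
  proof -
    obtain K where K: "\<forall>x\<in>M. norm (R x) \<le> K * norm x"
      using R by (auto simp: bounded_inverse_on_def)
    have Tsc: "(d * l) *\<^sub>C T x - (d * m) *\<^sub>C x = d *\<^sub>C (l *\<^sub>C T x - m *\<^sub>C x)" for x
      by (simp add: complex_vector.scale_right_diff_distrib scaleC_scaleC)
    \<comment> \<open>Rescaling the argument of \<open>R\<close> instead of its value avoids moving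
      scalars through \<open>T\<close>.\<close>
    define R' where "R' x = R (inverse d *\<^sub>C x)" for x
    have dd: "d *\<^sub>C inverse d *\<^sub>C x = x" "inverse d *\<^sub>C d *\<^sub>C x = x" for x :: 'a
      using d by (simp_all add: scaleC_scaleC scaleC_one)
    have "norm (R' x) \<le> (K * norm (inverse d)) * norm x" if "x \<in> M" for x
      using bspec [OF K M [OF that, of "inverse d"]] by (simp add: R'_def norm_scaleC mult.assoc)
    moreover have "inverse d *\<^sub>C (e *\<^sub>C x) = e *\<^sub>C (inverse d *\<^sub>C x)" for e and x :: 'a
      by (simp add: scaleC_scaleC mult.commute)
    then have "R' x \<in> M \<and> R' (e *\<^sub>C x) = e *\<^sub>C R' x" if "x \<in> M" for e x
      using R M [OF that] unfolding bounded_inverse_on_def R'_def by metis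
    moreover have "R' (x + y) = R' x + R' y" if "x \<in> M" "y \<in> M" for x y
      using R that M unfolding bounded_inverse_on_def R'_def by (metis scaleC_add_right)
    moreover have "R' (d *\<^sub>C (l *\<^sub>C T x - m *\<^sub>C x)) = x \<and> d *\<^sub>C (l *\<^sub>C T (R' x) - m *\<^sub>C R' x) = x"
      if "x \<in> M" for x
      using R that M [OF that] unfolding bounded_inverse_on_def R'_def by (metis dd)
    ultimately have "bounded_inverse_on M (\<lambda>x. d *\<^sub>C (l *\<^sub>C T x - m *\<^sub>C x)) R'"
      unfolding bounded_inverse_on_def by blast
    then show ?thesis
      unfolding Tsc by blast
  qed
  have "c * m \<in> spectrum_on M (\<lambda>x. c *\<^sub>C T x) \<longleftrightarrow> m \<in> spectrum_on M T" for m
    using scale [of c 1 m] scale [of "inverse c" c "c * m"] c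
    by (auto simp: spectrum_on_def scaleC_one mult.assoc [symmetric])
  moreover have "l = c * (l / c)" for l
    using c by simp
  ultimately show ?thesis
    by (metis (no_types, lifting) image_iff subsetI subset_antisym)
qed


section \<open>The splitting along the two isotropic lines\<close>

text \<open>The vector \<open>(y,0) + \<alpha>(u,1) + \<beta>(-u,1)\<close>.\<close>

definition light_cone_coords :: "'h::complex_inner \<Rightarrow> 'h \<Rightarrow> complex \<Rightarrow> complex \<Rightarrow> 'h \<times> complex"
  where "light_cone_coords u y \<alpha> \<beta> = (y + (\<alpha> - \<beta>) *\<^sub>C u, \<alpha> + \<beta>)"

lemma light_cone_coords_add:
  "light_cone_coords u y \<alpha> \<beta> + light_cone_coords u y' \<alpha>' \<beta>'
    = light_cone_coords u (y + y') (\<alpha> + \<alpha>') (\<beta> + \<beta>')"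
  by (simp add: light_cone_coords_def add_diff_add scaleC_add_left add_ac)

lemma light_cone_coords_scaleC:
  "c *\<^sub>C light_cone_coords u y \<alpha> \<beta> = light_cone_coords u (c *\<^sub>C y) (c * \<alpha>) (c * \<beta>)"
  by (simp add: light_cone_coords_def scaleC_prod_def scaleC_complex_def scaleC_add_right
      scaleC_scaleC right_diff_distrib distrib_left)

lemma light_cone_coords_diff:
  "light_cone_coords u y \<alpha> \<beta> - light_cone_coords u y' \<alpha>' \<beta>'
    = light_cone_coords u (y - y') (\<alpha> - \<alpha>') (\<beta> - \<beta>')"
  using light_cone_coords_add [of u "y - y'" "\<alpha> - \<alpha>'" "\<beta> - \<beta>'" y' \<alpha>' \<beta>']
  by (simp add: diff_eq_eq)

lemma light_cone_coords_zero: "light_cone_coords u 0 0 0 = 0"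
  by (simp add: light_cone_coords_def zero_prod_def)

text \<open>The diagonal form of a normal \<open>S\<close> with nonzero \<xi>, detached from its
  blocks; the phase is absorbed into \<open>W\<close>, \<open>p\<close> and \<open>q\<close>. As
  \<open>W\<close> is isometric, the conditions on the moduli of \<open>p\<close> and
  \<open>q\<close> keep these two eigenvalues away from those of \<open>W\<close>.\<close>

locale split_operator =
  fixes u :: "'h::complex_inner" and W :: "'h \<Rightarrow> 'h"
    and p q :: complex and S :: "'h \<times> complex \<Rightarrow> 'h \<times> complex"
  assumes norm_u: "norm u = 1"
    and W_closed: "cinner y u = 0 \<Longrightarrow> cinner (W y) u = 0"
    and W_norm: "norm (W y) = norm y"
    and S_coords: "cinner y u = 0 \<Longrightarrow>
      S (light_cone_coords u y \<alpha> \<beta>) = light_cone_coords u (W y) (p * \<alpha>) (q * \<beta>)"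
    and p_norm: "norm p \<noteq> 1" and q_norm: "norm q \<noteq> 1" and p_neq_q: "p \<noteq> q"
begin

abbreviation coords where "coords \<equiv> light_cone_coords u"

section \<open>Existence, uniqueness and norms of light-cone coordinates\<close>

lemma cinner_u: "cinner u u = 1"
  by (simp add: cinner_self norm_u)

lemma coords_cases:
  obtains y \<alpha> \<beta> where "cinner y u = 0" "v = coords y \<alpha> \<beta>"
proof -
  obtain x z where v: "v = (x, z)" by force
  define c where "c = cinner x u"
  \<comment> \<open>In coordinates \<open>c\<close> has to be \<alpha> - \<beta> and
    \<open>z\<close> has to be \<alpha> + \<beta>; the two halves solve this system.\<close>
  have "(z + c) / 2 - (z - c) / 2 = c" "(z + c) / 2 + (z - c) / 2 = z"
    by (simp_all add: field_simps)
  then show thesis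
    by (intro that [of "x - c *\<^sub>C u" "(z + c) / 2" "(z - c) / 2"])
      (simp_all add: light_cone_coords_def v cinner_diff_left cinner_scaleC_left cinner_u c_def)
qed

text \<open>Pairing the first component with \<open>u\<close> isolates \<alpha> - \<beta>, and the
  second component is \<alpha> + \<beta>.\<close>

lemma coords_eq_iff:
  assumes "cinner y u = 0" "cinner y' u = 0"
  shows "coords y \<alpha> \<beta> = coords y' \<alpha>' \<beta>' \<longleftrightarrow> y = y' \<and> \<alpha> = \<alpha>' \<and> \<beta> = \<beta>'"
proof
  assume eq: "coords y \<alpha> \<beta> = coords y' \<alpha>' \<beta>'"
  then have "cinner (y + (\<alpha> - \<beta>) *\<^sub>C u) u = cinner (y' + (\<alpha>' - \<beta>') *\<^sub>C u) u"
    by (simp add: light_cone_coords_def)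
  then have diff: "\<alpha> - \<beta> = \<alpha>' - \<beta>'"
    using assms by (simp add: cinner_add_left cinner_scaleC_left cinner_u)
  have sum: "\<alpha> + \<beta> = \<alpha>' + \<beta>'"
    using eq by (simp add: light_cone_coords_def)
  have "2 * \<alpha> = 2 * \<alpha>'"
    using arg_cong2 [OF diff sum, of "(+)"] by simp
  then show "y = y' \<and> \<alpha> = \<alpha>' \<and> \<beta> = \<beta>'"
    using eq sum by (auto simp: light_cone_coords_def)
qed simp

text \<open>The factors 2 are the squared norms of (u,1) and (-u,1); the cross terms cancel by the
  parallelogram law.\<close>

lemma norm_coords:
  assumes "cinner y u = 0"
  shows "(norm (coords y \<alpha> \<beta>))\<^sup>2 = (norm y)\<^sup>2 + 2 * (norm \<alpha>)\<^sup>2 + 2 * (norm \<beta>)\<^sup>2"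
proof -
  have "(norm (\<alpha> - \<beta>))\<^sup>2 + (norm (\<alpha> + \<beta>))\<^sup>2 = 2 * (norm \<alpha>)\<^sup>2 + 2 * (norm \<beta>)\<^sup>2"
    unfolding cmod_power2 by (simp add: power2_eq_square algebra_simps)
  moreover have "(norm (y + (\<alpha> - \<beta>) *\<^sub>C u))\<^sup>2 = (norm y)\<^sup>2 + (norm (\<alpha> - \<beta>))\<^sup>2"
    using assms by (simp add: pythagoras cinner_scaleC_right norm_scaleC norm_u)
  ultimately show ?thesis
    by (simp add: light_cone_coords_def norm_Pair)
qed

text \<open>Two-sided comparison of the norm with the coordinates, used to show that an inverse
  built coordinatewise is bounded.\<close>

lemma norm_coords_bounds:
  assumes "cinner y u = 0"
  shows "norm y \<le> norm (coords y \<alpha> \<beta>)" "norm \<alpha> \<le> norm (coords y \<alpha> \<beta>)"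
    "norm \<beta> \<le> norm (coords y \<alpha> \<beta>)"
    "norm (coords y \<alpha> \<beta>) \<le> norm y + 2 * norm \<alpha> + 2 * norm \<beta>"
proof -
  show "norm y \<le> norm (coords y \<alpha> \<beta>)" "norm \<alpha> \<le> norm (coords y \<alpha> \<beta>)"
    "norm \<beta> \<le> norm (coords y \<alpha> \<beta>)"
    by (rule power2_le_imp_le; simp add: norm_coords [OF assms])+
  show "norm (coords y \<alpha> \<beta>) \<le> norm y + 2 * norm \<alpha> + 2 * norm \<beta>"
  proof (rule power2_le_imp_le)
    show "(norm (coords y \<alpha> \<beta>))\<^sup>2 \<le> (norm y + 2 * norm \<alpha> + 2 * norm \<beta>)\<^sup>2"
      unfolding norm_coords [OF assms] by (simp add: power2_eq_square algebra_simps)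
  qed simp
qed

section \<open>Eigenvectors and eigenspaces of the split operator\<close>

lemma S_diff_coords:
  assumes "cinner y u = 0"
  shows "S (coords y \<alpha> \<beta>) - m *\<^sub>C coords y \<alpha> \<beta>
    = coords (W y - m *\<^sub>C y) ((p - m) * \<alpha>) ((q - m) * \<beta>)"
  by (simp add: S_coords [OF assms] light_cone_coords_scaleC light_cone_coords_diff left_diff_distrib)

lemma W_diff_orth: "cinner y u = 0 \<Longrightarrow> cinner (W y - m *\<^sub>C y) u = 0"
  by (simp add: cinner_diff_left cinner_scaleC_left W_closed)

lemma eigenvector_iff:
  assumes "cinner y u = 0"
  shows "S (coords y \<alpha> \<beta>) = m *\<^sub>C coords y \<alpha> \<beta> \<longleftrightarrow>
    W y = m *\<^sub>C y \<and> (p = m \<or> \<alpha> = 0) \<and> (q = m \<or> \<beta> = 0)"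
  using coords_eq_iff [OF W_diff_orth [OF assms, of m], of 0 "(p - m) * \<alpha>" "(q - m) * \<beta>" 0 0]
    S_diff_coords [OF assms, of \<alpha> \<beta> m]
  by (auto simp: light_cone_coords_zero)

text \<open>As \<open>W\<close> preserves norms, an eigenvector satisfies
  \<open>norm m * norm y = norm y\<close>.\<close>

lemma W_eigenvector_eq_0: "W y = m *\<^sub>C y \<Longrightarrow> norm m \<noteq> 1 \<Longrightarrow> y = 0"
  using W_norm [of y] by (simp add: norm_scaleC)

text \<open>The part in the complement of \<open>u\<close> vanishes because \<open>p\<close> is not
  of modulus 1, and the \<beta> part because \<open>p\<close> differs from \<open>q\<close>; the
  line of (u,1) remains.\<close>

lemma eigenspace_p: "eigenspace S p = cspan {(u, 1)}"
proof -
  have 1: "k *\<^sub>C (u, 1) = coords 0 k 0" for k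
    by (simp add: light_cone_coords_def scaleC_prod_def scaleC_complex_def)
  have "S v = p *\<^sub>C v \<longleftrightarrow> (\<exists>k. v = coords 0 k 0)" for v
  proof (rule coords_cases [of v])
    fix y \<alpha> \<beta> assume y: "cinner y u = 0" and v: "v = coords y \<alpha> \<beta>"
    \<comment> \<open>The locale does not make \<open>W\<close> linear, so this comes from norm
      preservation.\<close>
    have "W 0 = 0"
      using W_norm [of 0] by simp
    then show ?thesis
      using W_eigenvector_eq_0 [of y p] p_norm p_neq_q
      by (auto simp: v eigenvector_iff [OF y] coords_eq_iff [OF y])
  qed
  then show ?thesis
    by (auto simp: eigenspace_def complex_vector.span_singleton 1)
qed

lemma eigenspace_q: "eigenspace S q = cspan {(- u, 1)}"
proof -
  have 1: "k *\<^sub>C (- u, 1) = coords 0 0 k" for k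
    by (simp add: light_cone_coords_def scaleC_prod_def scaleC_complex_def)
  have "S v = q *\<^sub>C v \<longleftrightarrow> (\<exists>k. v = coords 0 0 k)" for v
  proof (rule coords_cases [of v])
    fix y \<alpha> \<beta> assume y: "cinner y u = 0" and v: "v = coords y \<alpha> \<beta>"
    have "W 0 = 0"
      using W_norm [of 0] by simp
    then show ?thesis
      using W_eigenvector_eq_0 [of y q] q_norm p_neq_q
      by (auto simp: v eigenvector_iff [OF y] coords_eq_iff [OF y])
  qed
  then show ?thesis
    by (auto simp: eigenspace_def complex_vector.span_singleton 1)
qed

section \<open>Invertibility and spectrum of the split operator\<close>

lemma bounded_inverse_from_complement:
  assumes R: "bounded_inverse_on {y. cinner y u = 0} (\<lambda>x. W x - m *\<^sub>C x) R"
    and "m \<noteq> p" "m \<noteq> q"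
  shows "\<exists>R'. bounded_inverse_on UNIV (\<lambda>x. S x - m *\<^sub>C x) R'"
proof -
  obtain K where K: "\<And>y. cinner y u = 0 \<Longrightarrow> norm (R y) \<le> K * norm y"
    using R by (auto simp: bounded_inverse_on_def)
  have R_orth: "cinner (R y) u = 0"
    and R_scaleC: "R (c *\<^sub>C y) = c *\<^sub>C R y"
    and R_left: "R (W y - m *\<^sub>C y) = y" and R_right: "W (R y) - m *\<^sub>C R y = y"
    if "cinner y u = 0" for y c
    using R that by (auto simp: bounded_inverse_on_def)
  have R_add: "R (y + y') = R y + R y'" if "cinner y u = 0" "cinner y' u = 0" for y y'
    using R that by (auto simp: bounded_inverse_on_def)
  \<comment> \<open>The inverse is \<open>R\<close> on the complement and division by
    \<open>p - m\<close> and \<open>q - m\<close> on the two lines. The formula extracts the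
    coordinates of \<open>v\<close>, with \<open>c\<close> equal to \<alpha> - \<beta>, so that it
    is defined for every vector.\<close>
  define R' where "R' v = (let c = cinner (fst v) u in
    coords (R (fst v - c *\<^sub>C u)) ((snd v + c) / 2 / (p - m)) ((snd v - c) / 2 / (q - m)))" for v
  have R': "R' (coords y \<alpha> \<beta>) = coords (R y) (\<alpha> / (p - m)) (\<beta> / (q - m))"
    if "cinner y u = 0" for y \<alpha> \<beta>
  proof -
    have "cinner (fst (coords y \<alpha> \<beta>)) u = \<alpha> - \<beta>"
      using that by (simp add: light_cone_coords_def cinner_add_left cinner_scaleC_left cinner_u)
    moreover have "fst (coords y \<alpha> \<beta>) - (\<alpha> - \<beta>) *\<^sub>C u = y"
      "(snd (coords y \<alpha> \<beta>) + (\<alpha> - \<beta>)) / 2 = \<alpha>"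
      "(snd (coords y \<alpha> \<beta>) - (\<alpha> - \<beta>)) / 2 = \<beta>"
      by (simp_all add: light_cone_coords_def)
    ultimately show ?thesis
      by (simp only: R'_def Let_def)
  qed
  have orth_add: "cinner (y + y') u = 0" if "cinner y u = 0" "cinner y' u = 0" for y y'
    using that by (simp add: cinner_add_left)
  have orth_scaleC: "cinner (c *\<^sub>C y) u = 0" if "cinner y u = 0" for y c
    using that by (simp add: cinner_scaleC_left)
  have "R' (v + w) = R' v + R' w" for v w
    by (rule coords_cases [of v], rule coords_cases [of w])
      (simp add: light_cone_coords_add R' R_add orth_add add_divide_distrib)
  moreover have "R' (c *\<^sub>C v) = c *\<^sub>C R' v" for c v
    by (rule coords_cases [of v]) (simp add: light_cone_coords_scaleC R' R_scaleC orth_scaleC)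
  moreover have "R' (S v - m *\<^sub>C v) = v \<and> S (R' v) - m *\<^sub>C R' v = v" for v
    by (rule coords_cases [of v])
      (use assms(2,3) in \<open>simp add: S_diff_coords R' R_orth R_left R_right W_diff_orth\<close>)
  moreover have "norm (R' v) \<le> (\<bar>K\<bar> + 2 / norm (p - m) + 2 / norm (q - m)) * norm v" for v
  proof (rule coords_cases [of v])
    fix y \<alpha> \<beta> assume y: "cinner y u = 0" and v: "v = coords y \<alpha> \<beta>"
    \<comment> \<open>\<open>K\<close> may be negative; its absolute value makes the bound monotone
      in the norm of the argument.\<close>
    have "norm (R y) \<le> \<bar>K\<bar> * norm y"
      using K [OF y] by (rule order_trans) (simp add: mult_right_mono)
    also have "\<dots> \<le> \<bar>K\<bar> * norm v"
      unfolding v by (intro mult_left_mono norm_coords_bounds y) simp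
    finally have 1: "norm (R y) \<le> \<bar>K\<bar> * norm v" .
    have "norm (R' v) \<le> norm (R y) + 2 * norm (\<alpha> / (p - m)) + 2 * norm (\<beta> / (q - m))"
      unfolding v R' [OF y] by (rule norm_coords_bounds) (rule R_orth [OF y])
    also have "\<dots> \<le> \<bar>K\<bar> * norm v + 2 * (norm v / norm (p - m)) + 2 * (norm v / norm (q - m))"
      unfolding norm_divide using norm_coords_bounds(2,3) [OF y]
      by (intro add_mono 1 mult_left_mono divide_right_mono) (simp_all add: v)
    finally show ?thesis
      by (simp add: algebra_simps)
  qed
  ultimately have "bounded_inverse_on UNIV (\<lambda>x. S x - m *\<^sub>C x) R'"
    unfolding bounded_inverse_on_def by blast
  then show ?thesis
    by blast
qed

text \<open>An inverse rules out eigenvectors, hence \<open>m\<close> is neither \<open>p\<close>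
  nor \<open>q\<close>. It must then preserve the complement of \<open>u\<close>, where it inverts
  \<open>W - m\<close>.\<close>

lemma bounded_inverse_on_complement:
  assumes R: "bounded_inverse_on UNIV (\<lambda>x. S x - m *\<^sub>C x) R"
  shows "m \<noteq> p" "m \<noteq> q"
    "\<exists>R'. bounded_inverse_on {y. cinner y u = 0} (\<lambda>x. W x - m *\<^sub>C x) R'"
proof -
  obtain K where K: "\<And>v. norm (R v) \<le> K * norm v"
    using R unfolding bounded_inverse_on_def by blast+
  have R_add: "R (v + w) = R v + R w" and R_scaleC: "R (c *\<^sub>C v) = c *\<^sub>C R v"
    and R_left: "R (S v - m *\<^sub>C v) = v" and R_right: "S (R v) - m *\<^sub>C R v = v" for v w c
    using R unfolding bounded_inverse_on_def by blast+
  have R0: "R 0 = 0"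
    using R_scaleC [of 0 0] by simp
  have W0: "W 0 = 0"
    using W_norm [of 0] by simp
  have no_eigenvector: "v = 0" if "S v = m *\<^sub>C v" for v
    using R_left [of v] that R0 by simp
  show mp: "m \<noteq> p"
  proof
    assume "m = p"
    then have "coords 0 1 0 = 0"
      by (intro no_eigenvector) (simp add: eigenvector_iff W0)
    then show False
      by (simp add: light_cone_coords_def zero_prod_def)
  qed
  show mq: "m \<noteq> q"
  proof
    assume "m = q"
    then have "coords 0 0 1 = 0"
      by (intro no_eigenvector) (simp add: eigenvector_iff W0)
    then show False
      by (simp add: light_cone_coords_def zero_prod_def)
  qed
  \<comment> \<open>A preimage of (y,0) has \<alpha> = \<beta> = 0, because \<open>p - m\<close> and
    \<open>q - m\<close> are nonzero and coordinates are unique.\<close>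
  have solve: "\<exists>y'. R (y, 0) = (y', 0) \<and> cinner y' u = 0 \<and> W y' - m *\<^sub>C y' = y"
    if y: "cinner y u = 0" for y
  proof (rule coords_cases [of "R (y, 0)"])
    fix y' \<alpha> \<beta> assume y': "cinner y' u = 0" and eq: "R (y, 0) = coords y' \<alpha> \<beta>"
    have "coords (W y' - m *\<^sub>C y') ((p - m) * \<alpha>) ((q - m) * \<beta>) = coords y 0 0"
      using R_right [of "(y, 0)"] unfolding eq S_diff_coords [OF y']
      by (simp add: light_cone_coords_def)
    then have "W y' - m *\<^sub>C y' = y" "\<alpha> = 0" "\<beta> = 0"
      using mp mq by (auto simp: coords_eq_iff W_diff_orth y y')
    then show ?thesis
      using eq y' by (simp add: light_cone_coords_def)
  qed
  define R' where "R' y = fst (R (y, 0))" for y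
  have pair: "R' (y + y') = R' y + R' y'" "R' (c *\<^sub>C y) = c *\<^sub>C R' y" for y y' c
    using R_add [of "(y, 0)" "(y', 0)"] R_scaleC [of c "(y, 0)"]
    by (simp_all add: R'_def scaleC_prod_def)
  have "norm (R' y) \<le> K * norm y" for y
    using norm_fst_le [of "fst (R (y, 0))" "snd (R (y, 0))"] K [of "(y, 0)"]
    by (simp add: R'_def norm_Pair)
  moreover have "cinner (R' y) u = 0 \<and> R' (W y - m *\<^sub>C y) = y \<and> W (R' y) - m *\<^sub>C R' y = y"
    if y: "cinner y u = 0" for y
  proof -
    have "S (y, 0) - m *\<^sub>C (y, 0) = (W y - m *\<^sub>C y, 0)"
      using S_diff_coords [OF y, of 0 0 m] by (simp add: light_cone_coords_def)
    then have "R' (W y - m *\<^sub>C y) = y"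
      using R_left [of "(y, 0)"] by (simp add: R'_def)
    then show ?thesis
      using solve [OF y] by (auto simp: R'_def)
  qed
  ultimately have "bounded_inverse_on {y. cinner y u = 0} (\<lambda>x. W x - m *\<^sub>C x) R'"
    unfolding bounded_inverse_on_def by (auto simp: pair)
  then show "\<exists>R'. bounded_inverse_on {y. cinner y u = 0} (\<lambda>x. W x - m *\<^sub>C x) R'"
    by blast
qed

lemma spectrum_split: "spectrum S = {p, q} \<union> spectrum_on {y. cinner y u = 0} W"
proof -
  have "(\<exists>R. bounded_inverse_on UNIV (\<lambda>x. S x - m *\<^sub>C x) R) \<longleftrightarrow>
    m \<noteq> p \<and> m \<noteq> q \<and> (\<exists>R. bounded_inverse_on {y. cinner y u = 0} (\<lambda>x. W x - m *\<^sub>C x) R)" for m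
  proof
    assume "\<exists>R. bounded_inverse_on UNIV (\<lambda>x. S x - m *\<^sub>C x) R"
    then obtain R where "bounded_inverse_on UNIV (\<lambda>x. S x - m *\<^sub>C x) R" ..
    from bounded_inverse_on_complement [OF this]
    show "m \<noteq> p \<and> m \<noteq> q \<and>
      (\<exists>R. bounded_inverse_on {y. cinner y u = 0} (\<lambda>x. W x - m *\<^sub>C x) R)"
      by (intro conjI)
  next
    assume "m \<noteq> p \<and> m \<noteq> q \<and>
      (\<exists>R. bounded_inverse_on {y. cinner y u = 0} (\<lambda>x. W x - m *\<^sub>C x) R)"
    then show "\<exists>R. bounded_inverse_on UNIV (\<lambda>x. S x - m *\<^sub>C x) R"
      by (elim conjE exE) (rule bounded_inverse_from_complement)
  qed
  then show ?thesis
    by (auto simp: spectrum_on_def)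
qed

text \<open>A fixed point \<open>x\<close> makes (x,1) an eigenvector whose eigenvalue is the
  denominator of the fraction.\<close>

lemma ball_map_fixed_iff:
  assumes S0: "snd (S (0, 1)) \<noteq> 0" and nonzero: "p \<noteq> 0" "q \<noteq> 0"
  shows "ball_map S x = x \<longleftrightarrow> x = u \<or> x = - u"
proof -
  have W0: "W 0 = 0"
    using W_norm [of 0] by simp
  have u0: "cinner 0 u = 0" by simp
  have pos: "S (u, 1) = p *\<^sub>C (u, 1)"
    using eigenvector_iff [OF u0, of 1 0 p] by (simp add: light_cone_coords_def W0)
  have neg: "S (- u, 1) = q *\<^sub>C (- u, 1)"
    using eigenvector_iff [OF u0, of 0 1 q] by (simp add: light_cone_coords_def W0)
  show ?thesis
  proof
    assume fixed: "ball_map S x = x"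
    define m where "m = snd (S (x, 1))"
    \<comment> \<open>With denominator 0 the convention \<open>inverse 0 = 0\<close> would make the
      value 0, so \<open>x = 0\<close>; \<open>S0\<close> excludes this spurious fixed
      point.\<close>
    have "m \<noteq> 0"
    proof
      assume "m = 0"
      then have "x = 0"
        using fixed by (simp add: ball_map_def m_def)
      then show False
        using S0 \<open>m = 0\<close> by (simp add: m_def)
    qed
    then have "m *\<^sub>C x = fst (S (x, 1))"
      using arg_cong [OF fixed, of "\<lambda>y. m *\<^sub>C y"]
      by (simp add: ball_map_def m_def scaleC_scaleC scaleC_one)
    then have eig: "S (x, 1) = m *\<^sub>C (x, 1)"
      by (simp add: prod_eq_iff scaleC_prod_def scaleC_complex_def m_def)
    obtain y \<alpha> \<beta> where y: "cinner y u = 0" and xy: "(x, 1) = coords y \<alpha> \<beta>"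
      using coords_cases by metis
    have mem: "W y = m *\<^sub>C y" "p = m \<or> \<alpha> = 0" "q = m \<or> \<beta> = 0"
      using eig unfolding xy eigenvector_iff [OF y] by auto
    have "\<alpha> + \<beta> = 1" and x: "x = y + (\<alpha> - \<beta>) *\<^sub>C u"
      using xy by (auto simp: light_cone_coords_def)
    \<comment> \<open>Not both coordinates vanish, as their sum is 1, and not both are nonzero, as
      \<open>p\<close> and \<open>q\<close> differ. Either way \<open>m\<close> is not of modulus 1,
      which forces \<open>y = 0\<close>.\<close>
    then consider "p = m" "\<alpha> = 1" "\<beta> = 0" | "q = m" "\<alpha> = 0" "\<beta> = 1"
      using mem p_neq_q by auto
    then show "x = u \<or> x = - u"
      using W_eigenvector_eq_0 [OF mem(1)] p_norm q_norm x by cases (auto simp: scaleC_one)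
  next
    assume "x = u \<or> x = - u"
    then show "ball_map S x = x"
      using nonzero by (auto simp: ball_map_def pos neg scaleC_prod_def scaleC_complex_def
          scaleC_scaleC scaleC_one)
  qed
qed

end

text \<open>The scalar \<open>cis \<theta>\<close> multiplies the whole spectrum and both
  eigenvalues, so it appears explicitly in the spectral claims; it leaves the moduli
  unchanged.\<close>

theorem theorem3p6:
  fixes S :: "'h::complex_hilbert \<times> complex \<Rightarrow> 'h \<times> complex"
    and U A :: "'h \<Rightarrow> 'h" and \<xi> :: 'h and \<theta> a :: real
  assumes infinite_dim: "\<nexists>E :: 'h set. finite E \<and> cspan E = UNIV"
    and a: "a = sqrt (1 + (norm \<xi>)\<^sup>2)"
    and U: "unitary_op U"
    and A: "positive_op A" "A \<xi> = complex_of_real a *\<^sub>C \<xi>" "\<forall>x \<in> corth (cspan {\<xi>}). A x = x"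
    and S_in: "S \<in> form_group"
    and S: "S = (\<lambda>v. cis \<theta> *\<^sub>C block_op (U \<circ> A) (U \<xi>) \<xi> (complex_of_real a) v)"
  shows
    "(normal_op S \<longleftrightarrow>
        S = (\<lambda>v. cis \<theta> *\<^sub>C block_op (U \<circ> A) \<xi> \<xi> (complex_of_real a) v)) \<and>
     (normal_op S \<longleftrightarrow> U \<xi> = \<xi>) \<and>
     (unitary_op S \<longleftrightarrow> S = (\<lambda>v. cis \<theta> *\<^sub>C block_op U 0 0 1 v)) \<and>
     (unitary_op S \<longleftrightarrow> \<xi> = 0) \<and>
     (normal_op S \<and> \<xi> \<noteq> 0 \<longrightarrow>
        spectrum S = (\<lambda>z. cis \<theta> * z) `
          ({complex_of_real (a + norm \<xi>), complex_of_real (a - norm \<xi>)}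
            \<union> spectrum_on (corth (cspan {\<xi>})) U) \<and>
        a + norm \<xi> > 0 \<and> a - norm \<xi> > 0 \<and>
        \<bar>a + norm \<xi>\<bar> \<noteq> 1 \<and> \<bar>a - norm \<xi>\<bar> \<noteq> 1 \<and>
        a - norm \<xi> = inverse (a + norm \<xi>) \<and>
        eigenspace S (cis \<theta> * complex_of_real (a + norm \<xi>))
          = cspan {(inverse (norm \<xi>) *\<^sub>R \<xi>, 1)} \<and>
        eigenspace S (cis \<theta> * complex_of_real (a - norm \<xi>))
          = cspan {(- (inverse (norm \<xi>) *\<^sub>R \<xi>), 1)}) \<and>
     (normal_op S \<and> \<xi> \<noteq> 0 \<longrightarrow> hyperbolic S)"
proof -
  define n where "n = norm \<xi>"
  define e where "e = cis \<theta>"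
  define M where "M = block_op A \<xi> \<xi> (complex_of_real a)"
  have e: "norm e = 1" "e \<noteq> 0" "cnj e * e = 1" "e * cnj e = 1"
    by (simp_all add: e_def cis_cnj cis_mult)
  have a2: "a\<^sup>2 = 1 + n\<^sup>2" and a_pos: "a > 0" and a_gt: "a > n"
    unfolding a n_def by (auto intro: real_less_rsqrt add_pos_nonneg)
  obtain V where U_lin: "bounded_clinear U" and V_lin: "bounded_clinear V"
    and UV: "is_cadjoint U V" and VU_id: "\<And>x. V (U x) = x" and UV_id: "\<And>x. U (V x) = x"
    and U_inner: "\<And>x y. cinner (U x) (U y) = cinner x y" and U_norm: "\<And>x. norm (U x) = norm x"
    using unitary_opE [OF U] by metis
  note U_add = bounded_clinear_add [OF U_lin] and U_scaleC = bounded_clinear_scaleC [OF U_lin]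
  have U0: "U 0 = 0"
    using U_scaleC [of 0 0] by simp
  have A_lin: "bounded_clinear A"
    using A(1) by (simp add: positive_op_def)
  note A_add = bounded_clinear_add [OF A_lin] and A_scaleC = bounded_clinear_scaleC [OF A_lin]
  have A_orth: "A y = y" if "cinner y \<xi> = 0" for y
    using A(3) that by (simp add: corth_cspan_singleton)

  \<comment> \<open>Splitting \<open>x\<close> along \<xi> gives the factor (a - 1)/n^2, which is
    1/(a + 1) since n^2 = a^2 - 1. In this form the formula also covers \<xi> = 0.\<close>
  have A_formula: "A x = x + (cinner x \<xi> / complex_of_real (a + 1)) *\<^sub>C \<xi>" for x
  proof (cases "\<xi> = 0")
    case False
    then have n: "n \<noteq> 0" by (simp add: n_def)
    define c where "c = cinner x \<xi> / complex_of_real (n\<^sup>2)"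
    have "cinner (x - c *\<^sub>C \<xi>) \<xi> = 0"
      using n by (simp add: cinner_diff_left cinner_scaleC_left cinner_self c_def n_def)
    then have "A ((x - c *\<^sub>C \<xi>) + c *\<^sub>C \<xi>) = (x - c *\<^sub>C \<xi>) + (c * a) *\<^sub>C \<xi>"
      by (simp only: A_add A_scaleC A(2) A_orth scaleC_scaleC)
    then have "A x = x + (c * complex_of_real (a - 1)) *\<^sub>C \<xi>"
      by (simp add: right_diff_distrib complex_vector.scale_left_diff_distrib)
    moreover have "c * complex_of_real (a - 1) = cinner x \<xi> / complex_of_real (a + 1)"
    proof -
      have "n\<^sup>2 = (a - 1) * (a + 1)"
        using a2 by (simp add: power2_eq_square algebra_simps)
      moreover from this have "a - 1 \<noteq> 0"
        using n by auto
      ultimately show ?thesis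
        by (simp add: c_def del: of_real_diff of_real_add)
    qed
    ultimately show ?thesis by simp
  qed (use A_orth in simp)
  have A_self: "is_cadjoint A A"
    unfolding is_cadjoint_def
  proof (intro allI)
    show "cinner (A x) y = cinner x (A y)" for x y
      using cinner_commute [of \<xi> y]
      by (simp add: A_formula cinner_add_left cinner_add_right cinner_scaleC_left cinner_scaleC_right)
  qed

  \<comment> \<open>The adjoint of \<open>S\<close> and the factorization of
    \<open>S\<close>\<close>
  define R where "R = (\<lambda>v. cnj e *\<^sub>C block_op (A \<circ> V) \<xi> (U \<xi>) (complex_of_real a) v)"
  have S_e: "S = (\<lambda>v. e *\<^sub>C block_op (U \<circ> A) (U \<xi>) \<xi> (complex_of_real a) v)"
    using S by (simp add: e_def)
  have SR_adj: "is_cadjoint S R"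
    using is_cadjoint_scale [OF is_cadjoint_block_op [OF is_cadjoint_compose [OF UV A_self]]]
    unfolding S_e R_def by (metis complex_cnj_complex_of_real)
  have S_lin: "bounded_clinear S" and R_lin: "bounded_clinear R"
    unfolding S_e R_def
    by (intro bounded_clinear_scale bounded_clinear_block_op bounded_clinear_compose U_lin V_lin A_lin)+
  have R_unique: "R' = R" if "is_cadjoint S R'" for R'
    using is_cadjoint_unique that SR_adj by blast

  \<comment> \<open>\<open>J\<close> is U \<oplus> 1 and \<open>J'\<close> its inverse. Then
    \<open>S\<close> is \<open>J M\<close> and \<open>R\<close> is \<open>M J'\<close> up to
    conjugate phases, which cancel in both products.\<close>
  define J where "J = (\<lambda>v :: 'h \<times> complex. (U (fst v), snd v))"
  define J' where "J' = (\<lambda>v :: 'h \<times> complex. (V (fst v), snd v))"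
  have J'J: "J' (J v) = v" and JJ': "J (J' v) = v" for v
    by (simp_all add: J_def J'_def VU_id UV_id)
  have V_xi: "cinner (V x) \<xi> = cinner x (U \<xi>)" for x
    by (metis U_inner UV_id)
  have S_M: "S v = e *\<^sub>C J (M v)" for v
    by (simp add: S_e M_def J_def block_op_def split_beta U_add U_scaleC)
  have R_M: "R v = cnj e *\<^sub>C M (J' v)" for v
    by (simp add: R_def M_def J'_def block_op_def split_beta V_xi)
  have RS: "R (S v) = M (M v)" for v
  proof -
    have "R (S v) = e *\<^sub>C R (J (M v))"
      unfolding S_M by (rule bounded_clinear_scaleC [OF R_lin])
    then show ?thesis
      by (simp only: R_M J'J scaleC_scaleC e scaleC_one)
  qed
  have SR: "S (R v) = J (M (M (J' v)))" for v
  proof -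
    have "S (R v) = cnj e *\<^sub>C S (M (J' v))"
      unfolding R_M by (rule bounded_clinear_scaleC [OF S_lin])
    then show ?thesis
      by (simp only: S_M scaleC_scaleC e scaleC_one)
  qed
  have S01: "S (0, 1) = e *\<^sub>C (U \<xi>, complex_of_real a)"
    by (simp add: S_e block_op_def U0 A_orth scaleC_one)

  \<comment> \<open>Normality\<close>
  have normal: "normal_op S \<longleftrightarrow> U \<xi> = \<xi>"
  proof
    assume "normal_op S"
    then have "R (S (0, 1)) = S (R (0, 1))"
      using R_unique unfolding normal_op_def by (metis comp_apply)
    moreover have "J' (0, 1) = (0, 1)"
      using VU_id [of 0] by (simp add: J'_def U0)
    \<comment> \<open>As \<open>J'\<close> fixes (0,1), comparing \<open>R S\<close> and
      \<open>S R\<close> there shows that \<open>U\<close> fixes 2a \<xi>, the first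
      component.\<close>
    moreover have "M (M (0, 1)) = ((2 * complex_of_real a) *\<^sub>C \<xi>, cinner \<xi> \<xi> + a * a)"
      by (simp add: M_def block_op_def A_orth A(2) scaleC_one flip: scaleC_add_left)
    ultimately have "(2 * complex_of_real a) *\<^sub>C U \<xi> = (2 * complex_of_real a) *\<^sub>C \<xi>"
      by (auto simp: RS SR J_def U_scaleC)
    then show "U \<xi> = \<xi>"
      using a_pos by simp
  next
    assume xi_fixed: "U \<xi> = \<xi>"
    \<comment> \<open>A unitary fixing \<xi> preserves the functional given by \<xi>, so
      \<open>J\<close> commutes with \<open>M\<close> itself.\<close>
    have "cinner (U x) \<xi> = cinner x \<xi>" for x
      using U_inner [of x \<xi>] by (simp add: xi_fixed)
    then have "J (M v) = M (J v)" for v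
      by (simp add: J_def M_def block_op_def split_beta A_formula U_add U_scaleC xi_fixed)
    then have "R \<circ> S = S \<circ> R"
      by (simp add: fun_eq_iff RS SR JJ')
    then show "normal_op S"
      using S_lin R_lin SR_adj unfolding normal_op_def by blast
  qed
  have normal': "normal_op S \<longleftrightarrow>
      S = (\<lambda>v. cis \<theta> *\<^sub>C block_op (U \<circ> A) \<xi> \<xi> (complex_of_real a) v)"
  proof
    assume "normal_op S"
    then show "S = (\<lambda>v. cis \<theta> *\<^sub>C block_op (U \<circ> A) \<xi> \<xi> (complex_of_real a) v)"
      using S normal by simp
  next
    assume "S = (\<lambda>v. cis \<theta> *\<^sub>C block_op (U \<circ> A) \<xi> \<xi> (complex_of_real a) v)"
    \<comment> \<open>Evaluation at (0,1) recovers the last column of the block matrix.\<close>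
    then have "S (0, 1) = e *\<^sub>C (\<xi>, complex_of_real a)"
      by (simp add: e_def block_op_def U0 A_orth scaleC_one)
    then have "e *\<^sub>C U \<xi> = e *\<^sub>C \<xi>"
      by (simp add: S01 scaleC_prod_def)
    then show "normal_op S"
      using e(2) by (simp add: normal)
  qed

  \<comment> \<open>Unitarity\<close>
  have unitary: "unitary_op S \<longleftrightarrow> \<xi> = 0"
  proof
    assume "unitary_op S"
    then have "norm (S (0, 1)) = norm (0 :: 'h, 1 :: complex)"
      by (rule unitary_opE)
    \<comment> \<open>Together with a^2 = 1 + n^2 this leaves only n = 0.\<close>
    then have "sqrt (n\<^sup>2 + a\<^sup>2) = 1"
      by (simp add: S01 norm_scaleC e norm_Pair U_norm n_def)
    then show "\<xi> = 0"
      using a2 by (simp add: n_def)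
  next
    assume xi: "\<xi> = 0"
    have "M v = v" for v
      by (simp add: M_def block_op_def split_beta xi A_orth a)
    then have "R \<circ> S = id" "S \<circ> R = id"
      by (simp_all add: fun_eq_iff RS SR JJ')
    then show "unitary_op S"
      using S_lin R_lin SR_adj unfolding unitary_op_def by blast
  qed
  have unitary': "unitary_op S \<longleftrightarrow> S = (\<lambda>v. cis \<theta> *\<^sub>C block_op U 0 0 1 v)"
  proof
    assume "unitary_op S"
    then have "\<xi> = 0"
      by (simp add: unitary)
    then show "S = (\<lambda>v. cis \<theta> *\<^sub>C block_op U 0 0 1 v)"
      by (simp add: S fun_eq_iff block_op_def split_beta A_orth U0 a)
  next
    assume "S = (\<lambda>v. cis \<theta> *\<^sub>C block_op U 0 0 1 v)"
    then have "snd (S (0, 1)) = e"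
      by (simp add: e_def block_op_def scaleC_prod_def scaleC_complex_def)
    then have "a = 1"
      using e(2) by (simp add: S01 scaleC_prod_def scaleC_complex_def)
    then show "unitary_op S"
      using a2 by (simp add: unitary n_def)
  qed

  \<comment> \<open>Spectrum, eigenspaces and fixed points in the normal case with nonzero
    \<xi>\<close>
  have hyperbolic_case:
    "spectrum S = (\<lambda>z. cis \<theta> * z) `
        ({complex_of_real (a + norm \<xi>), complex_of_real (a - norm \<xi>)}
          \<union> spectrum_on (corth (cspan {\<xi>})) U) \<and>
      a + norm \<xi> > 0 \<and> a - norm \<xi> > 0 \<and>
      \<bar>a + norm \<xi>\<bar> \<noteq> 1 \<and> \<bar>a - norm \<xi>\<bar> \<noteq> 1 \<and>
      a - norm \<xi> = inverse (a + norm \<xi>) \<and>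
      eigenspace S (cis \<theta> * complex_of_real (a + norm \<xi>))
        = cspan {(inverse (norm \<xi>) *\<^sub>R \<xi>, 1)} \<and>
      eigenspace S (cis \<theta> * complex_of_real (a - norm \<xi>))
        = cspan {(- (inverse (norm \<xi>) *\<^sub>R \<xi>), 1)} \<and> hyperbolic S"
    if "normal_op S" and xi: "\<xi> \<noteq> 0"
  proof -
    have xi_fixed: "U \<xi> = \<xi>"
      using that normal by simp
    have n_pos: "n > 0"
      using xi by (simp add: n_def)
    have prod: "(a - n) * (a + n) = 1"
      using a2 by (simp add: power2_eq_square algebra_simps)
    \<comment> \<open>If either factor of \<open>prod\<close> were 1, so would be the other, forcing
      n = 0.\<close>
    have plus_neq: "a + n \<noteq> 1" and minus_neq: "a - n \<noteq> 1"
      using prod n_pos by auto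
    have inv: "a - n = inverse (a + n)"
      using prod a_pos n_pos by (simp add: divide_simps)
    define u where "u = inverse n *\<^sub>R \<xi>"
    have u_xi: "u = complex_of_real (inverse n) *\<^sub>C \<xi>"
      by (simp only: u_def scaleC_of_real)
    have xi_u: "\<xi> = complex_of_real n *\<^sub>C u"
      using n_pos by (simp add: u_def scaleC_of_real)
    have norm_u: "norm u = 1"
      using xi by (simp add: u_def n_def)
    have orth: "cinner y u = 0 \<longleftrightarrow> cinner y \<xi> = 0" for y
      using n_pos by (simp add: u_xi cinner_scaleC_right)
    have U_u: "U u = u" and A_u: "A u = complex_of_real a *\<^sub>C u"
      by (simp_all add: u_xi U_scaleC A_scaleC A(2) xi_fixed scaleC_scaleC mult.commute)
    interpret split_operator u "\<lambda>x. e *\<^sub>C U x" "e * complex_of_real (a + n)"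
      "e * complex_of_real (a - n)" S
    proof
      show "norm u = 1" by (fact norm_u)
      show "cinner (e *\<^sub>C U y) u = 0" if "cinner y u = 0" for y
        using U_inner [of y u] that by (simp add: U_u cinner_scaleC_left)
      show "norm (e *\<^sub>C U y) = norm y" for y
        by (simp add: norm_scaleC e U_norm)
      show "norm (e * complex_of_real (a + n)) \<noteq> 1" "norm (e * complex_of_real (a - n)) \<noteq> 1"
        unfolding norm_mult e norm_of_real using plus_neq minus_neq a_gt a_pos n_pos by auto
      show "e * complex_of_real (a + n) \<noteq> e * complex_of_real (a - n)"
        unfolding mult_left_cancel [OF e(2)] of_real_eq_iff using n_pos by simp
      show "S (light_cone_coords u y \<alpha> \<beta>) = light_cone_coords u (e *\<^sub>C U y)
          (e * complex_of_real (a + n) * \<alpha>) (e * complex_of_real (a - n) * \<beta>)"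
        if y: "cinner y u = 0" for y \<alpha> \<beta>
      proof -
        \<comment> \<open>\<open>k\<close> is the difference of the two new line coordinates, hence
          the coefficient of \<open>u\<close> in the image.\<close>
        define k where "k = (a + n) * \<alpha> - (a - n) * \<beta>"
        have "A (y + (\<alpha> - \<beta>) *\<^sub>C u) + (\<alpha> + \<beta>) *\<^sub>C \<xi>
            = y + ((\<alpha> - \<beta>) * a + (\<alpha> + \<beta>) * n) *\<^sub>C u"
          using A_orth [of y] y
          by (simp only: A_add A_scaleC A_u orth xi_u [symmetric] scaleC_add_left add.assoc
              scaleC_scaleC [symmetric])
        also have "(\<alpha> - \<beta>) * a + (\<alpha> + \<beta>) * n = k"
          by (simp add: k_def algebra_simps)
        finally have 1: "A (y + (\<alpha> - \<beta>) *\<^sub>C u) + (\<alpha> + \<beta>) *\<^sub>C \<xi> = y + k *\<^sub>C u" .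
        have 2: "cinner (y + (\<alpha> - \<beta>) *\<^sub>C u) \<xi> = (\<alpha> - \<beta>) * n"
          using y norm_u by (simp add: cinner_add_left cinner_scaleC_left xi_u
              cinner_scaleC_right cinner_self)
        have "M (light_cone_coords u y \<alpha> \<beta>)
            = (y + k *\<^sub>C u, (a + n) * \<alpha> + (a - n) * \<beta>)"
          by (simp add: M_def block_op_def light_cone_coords_def 1 2) (simp add: algebra_simps)
        then have "J (M (light_cone_coords u y \<alpha> \<beta>))
            = light_cone_coords u (U y) ((a + n) * \<alpha>) ((a - n) * \<beta>)"
          by (simp add: J_def U_add U_scaleC U_u light_cone_coords_def k_def)
        then show ?thesis
          by (simp add: S_M light_cone_coords_scaleC mult.assoc)
      qed
    qed
    have "{y. cinner y u = 0} = corth (cspan {\<xi>})"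
      by (simp add: orth corth_cspan_singleton)
    \<comment> \<open>The phase was absorbed into \<open>W\<close>; here it is pulled back out of
      the spectrum.\<close>
    moreover have "spectrum_on (corth (cspan {\<xi>})) (\<lambda>x. e *\<^sub>C U x)
        = (\<lambda>z. e * z) ` spectrum_on (corth (cspan {\<xi>})) U"
      by (rule spectrum_on_scale [OF e(2)]) (simp add: corth_cspan_singleton cinner_scaleC_left)
    ultimately have "spectrum S = (\<lambda>z. e * z) `
        ({complex_of_real (a + n), complex_of_real (a - n)} \<union> spectrum_on (corth (cspan {\<xi>})) U)"
      using spectrum_split by (simp add: image_Un)
    moreover have "hyperbolic S"
    proof -
      have "snd (S (0, 1)) \<noteq> 0"
        using a_pos e(2) by (simp add: S01 scaleC_prod_def scaleC_complex_def)
      moreover have "e * complex_of_real (a + n) \<noteq> 0" "e * complex_of_real (a - n) \<noteq> 0"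
        unfolding mult_eq_0_iff of_real_eq_0_iff using e(2) a_gt a_pos n_pos by auto
      \<comment> \<open>The only fixed points are two unit vectors, so none lies in the open
        ball.\<close>
      ultimately have fixed: "ball_map S x = x \<longleftrightarrow> x = u \<or> x = - u" for x
        by (rule ball_map_fixed_iff)
      have "u \<noteq> - u"
      proof
        assume "u = - u"
        then have "2 *\<^sub>R u = 0"
          by (simp add: scaleR_2 eq_neg_iff_add_eq_0)
        then show False
          using norm_u by auto
      qed
      moreover have "{x \<in> sphere 0 1. ball_map S x = x} = {u, - u}"
        using norm_u by (auto simp: fixed)
      moreover have "\<not> elliptic S"
        using norm_u by (auto simp: elliptic_def fixed)
      ultimately show ?thesis
        by (simp add: hyperbolic_def)
    qed
    ultimately show ?thesis
      using a_gt a_pos n_pos plus_neq minus_neq inv eigenspace_p eigenspace_q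
      unfolding n_def [symmetric] e_def [symmetric] u_def by simp
  qed
  show ?thesis
    using normal normal' unitary unitary' hyperbolic_case by blast
qed

end
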